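(* Let $\mathcal X$ be a finite alphabet, let $\mathcal M$ be a finite or countable set of probability distributions on infinite sequences over $\mathcal X$, let $\mu\in\mathcal M$, and let $\xi=\sum_{\nu\in\mathcal M}w_\nu\,\nu$ with $w_\nu>0$ for all $\nu\in\mathcal M$ and $\sum_{\nu\in\mathcal M}w_\nu=1$. Let sequences $x_1x_2\ldots$ over $\mathcal X$ be drawn with probability $\mu(x_{1:n})$ for the first $n$ symbols. For $x'_t\in\mathcal X$ write $\xi'_t:=\xi(x'_t|x_{<t})$ and $\mu'_t:=\mu(x'_t|x_{<t})$, and for the actually drawn symbol $x_t$ write $\xi_t:=\xi(x_t|x_{<t})$ and $\mu_t:=\mu(x_t|x_{<t})$. With $s_t,h_t,d_t,a_t,b_t$ and $S_n,H_n,D_n,A_n,B_n$ as defined in the context, the following hold (for all $n\ge 1$, all $t\ge1$, and all histories $x_{<t}$ with $\mu(x_{<t})>0$, where applicable): (i) $\sum_{t=1}^n\mathbf E\big[\sum_{x'_t\in\mathcal X}(\mu'_t-\xi'_t)^2\big]\equiv S_n\le D_n\le \ln w_\mu^{-1}<\infty$; (ii) $\sum_{x'_t\in\mathcal X}(\mu'_t-\xi'_t)^2\equiv s_t(x_{<t})\le d_t(x_{<t})$, and $d_t(x_{<t})\to 0$ for $t\to\infty$ with $\mu$-probability 1; (iii) $\xi'_t-\mu'_t\to 0$ for $t\to\infty$ with $\mu$-probability 1 (and in mean sum), for any choice of symbols $x'_t\in\mathcal X$; (iv) $\sum_{t=1}^n\mathbf E\Big[\big(\sqrt{\xi_t/\mu_t}-1\big)^2\Big]\le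 H_n\le D_n\le\ln w_\mu^{-1}<\infty$; (v) $\sqrt{\xi_t/\mu_t}\to 1$ in mean sum, and $\xi_t/\mu_t\to 1$ with $\mu$-probability 1, for $t\to\infty$; (vi) $b_t-d_t\le a_t\le\sqrt{2d_t}$ and $B_n-D_n\le A_n\le\sqrt{2nD_n}$.
   Context: Strings: $x_{1:n}:=x_1\ldots x_n$ and $x_{<t}:=x_1\ldots x_{t-1}$. For a probability distribution $\rho$ on infinite sequences, $\rho(x_{1:t})$ is the probability that the sequence starts with $x_1\ldots x_t$, and $\rho(x_t|x_{<t}):=\rho(x_{1:t})/\rho(x_{<t})$. The mixture is $\xi(x_{1:n}):=\sum_{\nu\in\mathcal M}w_\nu\,\nu(x_{1:n})$. $\mathbf E$ denotes expectation with respect to $\mu$ (sums are over strings of positive $\mu$-probability). Random variables $z_t$ converge to $z_*$ in mean sum if $\sum_{t=1}^\infty\mathbf E[(z_t-z_* )^2]<\infty$; with $\mu$-probability 1 if $\mu\{z_t\to z_*\}=1$. Instantaneous distances, where the sums run over $x\in\mathcal X$, and we abbreviate $\mu^x:=\mu(x|x_{<t})$, $\xi^x:=\xi(x|x_{<t})$ (with $0\ln 0:=0$): $a_t(x_{<t}):=\sum_x|\mu^x-\xi^x|$, $s_t(x_{<t}):=\sum_x(\mu^x-\xi^x)^2$, $h_t(x_{<t}):=\sum_x(\sqrt{\mu^x}-\sqrt{\xi^x})^2$, $d_t(x_{<t}):=\sum_x\mu^x\ln\frac{\mu^x}{\xi^x}$, $b_t(x_{<t}):=\sum_x\mu^x\big|\ln\frac{\mu^x}{\xi^x}\big|$.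 Total distances: $A_n:=\sum_{t=1}^n\mathbf E[a_t]$, $S_n:=\sum_{t=1}^n\mathbf E[s_t]$, $H_n:=\sum_{t=1}^n\mathbf E[h_t]$, $D_n:=\sum_{t=1}^n\mathbf E[d_t]$, $B_n:=\sum_{t=1}^n\mathbf E[b_t]$. *)

theory Defs
  imports "HOL-Probability.Probability"
begin

definition prefix_prob :: "'a::finite stream measure \<Rightarrow> 'a list \<Rightarrow> real" where
  "prefix_prob \<rho> x = measure \<rho> {\<omega> \<in> space \<rho>. stake (length x) \<omega> = x}"

definition mixture ::
    "'a::finite stream measure set \<Rightarrow> ('a stream measure \<Rightarrow> real) \<Rightarrow> 'a list \<Rightarrow> real" where
  "mixture M w x = (\<Sum>\<^sub>\<infinity>\<nu>\<in>M. w \<nu> * prefix_prob \<nu> x)"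

definition predict :: "('a list \<Rightarrow> real) \<Rightarrow> 'a list \<Rightarrow> 'a \<Rightarrow> real" where
  "predict p h x = p (h @ [x]) / p h"

text \<open>Instantaneous distances between the predictions of \<open>p\<close> and \<open>q\<close> at time
  \<open>t = length h + 1\<close> after the history \<open>h\<close>. The convention \<open>0 ln 0 = 0\<close> holds
  automatically, as \<open>ln\<close> is total.\<close>

definition dist_a :: "('a::finite list \<Rightarrow> real) \<Rightarrow> ('a list \<Rightarrow> real) \<Rightarrow> 'a list \<Rightarrow> real" where
  "dist_a p q h = (\<Sum>x\<in>UNIV. \<bar>predict p h x - predict q h x\<bar>)"

definition dist_s :: "('a::finite list \<Rightarrow> real) \<Rightarrow> ('a list \<Rightarrow> real) \<Rightarrow> 'a list \<Rightarrow> real" where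
  "dist_s p q h = (\<Sum>x\<in>UNIV. (predict p h x - predict q h x)\<^sup>2)"

definition dist_h :: "('a::finite list \<Rightarrow> real) \<Rightarrow> ('a list \<Rightarrow> real) \<Rightarrow> 'a list \<Rightarrow> real" where
  "dist_h p q h = (\<Sum>x\<in>UNIV. (sqrt (predict p h x) - sqrt (predict q h x))\<^sup>2)"

definition dist_d :: "('a::finite list \<Rightarrow> real) \<Rightarrow> ('a list \<Rightarrow> real) \<Rightarrow> 'a list \<Rightarrow> real" where
  "dist_d p q h = (\<Sum>x\<in>UNIV. predict p h x * ln (predict p h x / predict q h x))"

definition dist_b :: "('a::finite list \<Rightarrow> real) \<Rightarrow> ('a list \<Rightarrow> real) \<Rightarrow> 'a list \<Rightarrow> real" where
  "dist_b p q h = (\<Sum>x\<in>UNIV. predict p h x * \<bar>ln (predict p h x / predict q h x)\<bar>)"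

text \<open>The first \<open>t - 1\<close> symbols of \<open>\<omega>\<close> are the history at time \<open>t\<close>. Strings of
  \<open>\<mu>\<close>-probability \<open>0\<close>, where \<open>f\<close> may take junk values from division by zero, do not
  contribute to the integral, so this is the sum over strings of positive probability.\<close>

definition total_dist :: "'a::finite stream measure \<Rightarrow> ('a list \<Rightarrow> real) \<Rightarrow> nat \<Rightarrow> real" where
  "total_dist \<mu> f n = (\<Sum>t=1..n. \<integral>\<omega>. f (stake (t - 1) \<omega>) \<partial>\<mu>)"

text \<open>Time starts at \<open>t = 1\<close>; integrability is demanded because the Bochner integral of a
  non-integrable function is \<open>0\<close>.\<close>

definition converges_in_mean_sum ::
    "'b measure \<Rightarrow> (nat \<Rightarrow> 'b \<Rightarrow> real) \<Rightarrow> ('b \<Rightarrow> real) \<Rightarrow> bool" where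
  "converges_in_mean_sum \<mu> z zs \<longleftrightarrow>
     (\<forall>t\<ge>1. integrable \<mu> (\<lambda>\<omega>. (z t \<omega> - zs \<omega>)\<^sup>2)) \<and>
     summable (\<lambda>k. \<integral>\<omega>. (z (Suc k) \<omega> - zs \<omega>)\<^sup>2 \<partial>\<mu>)"

text \<open>The mixture dominates each of its components. In particular \<open>dist_d\<close> and \<open>dist_b\<close> never
  divide a positive \<open>\<mu>\<close>-probability by \<open>0\<close>, where the true value would be \<open>\<infinity>\<close> rather
  than a real number.\<close>

lemma mixture_dominates:
  fixes M :: "'a::finite stream measure set"
  assumes "\<And>\<nu>. \<nu> \<in> M \<Longrightarrow> prob_space \<nu>"
    and pos: "\<And>\<nu>. \<nu> \<in> M \<Longrightarrow> 0 < w \<nu>"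
    and sum: "(w has_sum 1) M"
    and "\<mu> \<in> M"
  shows "w \<mu> * prefix_prob \<mu> x \<le> mixture M w x"
proof -
  have bd: "0 \<le> prefix_prob \<nu> x \<and> prefix_prob \<nu> x \<le> 1" if "\<nu> \<in> M" for \<nu>
    using assms(1)[OF that] by (simp add: prefix_prob_def prob_space.prob_le_1)
  have "w summable_on M"
    using sum by (rule has_sum_imp_summable)
  then have sm: "(\<lambda>\<nu>. w \<nu> * prefix_prob \<nu> x) summable_on M"
    by (rule summable_on_comparison_test) (use bd pos in \<open>auto simp: mult_left_le less_imp_le\<close>)
  have "(\<Sum>\<^sub>\<infinity>\<nu>\<in>{\<mu>}. w \<nu> * prefix_prob \<nu> x) \<le> mixture M w x"
    unfolding mixture_def
    by (rule infsum_mono_neutral) (use sm bd pos \<open>\<mu> \<in> M\<close> in \<open>auto simp: less_imp_le\<close>)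
  then show ?thesis
    by simp
qed

end

theory Submission
  imports Defs
begin

text \<open>The chain rule gives \<open>D\<^sub>n = E[ln (\<mu>(x\<^sub>1\<dots>x\<^sub>n) / \<xi>(x\<^sub>1\<dots>x\<^sub>n))]\<close>, and the mixture dominates
  \<open>w\<^sub>\<mu> \<mu>\<close>, so \<open>D\<^sub>n \<le> ln w\<^sub>\<mu>\<inverse>\<close> uniformly in \<open>n\<close>. All other distances are compared with \<open>d\<^sub>t\<close> for
  each history separately: Pinsker's inequality bounds \<open>a\<^sub>t\<^sup>2\<close> by \<open>2 d\<^sub>t\<close>, the zero sum of \<open>\<mu> - \<xi>\<close>
  bounds \<open>s\<^sub>t\<close> by \<open>a\<^sub>t\<^sup>2 / 2\<close>, and \<open>ln u \<le> u - 1\<close> at \<open>u = \<surd>(\<xi>/\<mu>)\<close> bounds \<open>h\<^sub>t\<close>. Almost sure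
  convergence then follows because non-negative functions with a finite sum of expectations are
  almost surely summable.\<close>

subsection \<open>Distances between finite distributions\<close>

text \<open>The difference \<open>f\<close> of the two sides vanishes at 1 and has derivative
  \<open>(t - 1) ^ 3 / (t * (t + 2))\<^sup>2\<close>, which has the sign of \<open>t - 1\<close>.
  Hence \<open>f\<close> attains its minimum 0 at 1.\<close>

lemma ln_ge_rational:
  fixes t :: real
  assumes "t > 0"
  shows "(t - 1) * (5 * t + 1) / (2 * t * (t + 2)) \<le> ln t"
proof -
  define f where "f = (\<lambda>t::real. ln t - (t - 1) * (5 * t + 1) / (2 * t * (t + 2)))"
  define f' where "f' = (\<lambda>t::real. (t - 1) ^ 3 / (t * (t + 2))\<^sup>2)"
  have deriv: "(f has_real_derivative f' x) (at x)" if "x > 0" for x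
  proof -
    have nz: "x \<noteq> 0" "x + 2 \<noteq> 0" using that by auto
    \<comment> \<open>The left side is the derivative of \<open>f\<close> as the quotient rule
      delivers it; its numerator collapses to a cube.\<close>
    have *: "1 / x - ((5 * x + 1 + (x - 1) * 5) * (2 * x * (x + 2))
        - (x - 1) * (5 * x + 1) * (2 * (x + 2) + 2 * x)) / (2 * x * (x + 2))\<^sup>2 = f' x"
      unfolding f'_def using nz
      by (simp add: divide_simps) (simp add: algebra_simps power2_eq_square power3_eq_cube)
    have num: "((\<lambda>t. (t - 1) * (5 * t + 1)) has_real_derivative 5 * x + 1 + (x - 1) * 5) (at x)"
      by (auto intro!: derivative_eq_intros)
    have den: "((\<lambda>t. 2 * t * (t + 2)) has_real_derivative 2 * (x + 2) + 2 * x) (at x)"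
      by (auto intro!: derivative_eq_intros)
    have "2 * x * (x + 2) \<noteq> 0" using nz by simp
    from DERIV_diff[OF DERIV_ln_divide[OF that] DERIV_divide[OF num den this]]
    show ?thesis
      unfolding f_def *[symmetric] power2_eq_square by (simp add: mult.commute)
  qed
  have "f 1 \<le> f t"
  proof (cases "t \<le> 1")
    case True
    then show ?thesis
    proof (rule DERIV_nonpos_imp_nonincreasing)
      fix x assume "t \<le> x" "x \<le> 1"
      moreover from this have "(x - 1) ^ 3 \<le> 0"
        by (simp add: power3_eq_cube mult_nonneg_nonpos)
      ultimately show "\<exists>y. DERIV f x :> y \<and> y \<le> 0"
        using deriv[of x] assms by (auto simp: f'_def divide_nonpos_nonneg intro!: exI[of _ "f' x"])
    qed
  next
    case False
    then have "1 \<le> t" by simp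
    then show ?thesis
    proof (rule DERIV_nonneg_imp_nondecreasing)
      fix x assume "1 \<le> x" "x \<le> t"
      then show "\<exists>y. DERIV f x :> y \<and> 0 \<le> y"
        using deriv[of x] by (auto simp: f'_def intro!: exI[of _ "f' x"])
    qed
  qed
  then show ?thesis by (simp add: f_def)
qed

text \<open>The summand of Pinsker's inequality. The weight \<open>y + 2 z\<close> makes the Taylor expansions of
  both sides at \<open>y = z\<close> agree to third order.\<close>

lemma kl_term_ge_quadratic:
  fixes y z :: real
  assumes "y \<ge> 0" "z \<ge> 0" "y > 0 \<Longrightarrow> z > 0"
  shows "3 / 2 * ((y - z)\<^sup>2 / (y + 2 * z)) \<le> y * ln (y / z) - y + z"
proof (cases "y > 0")
  case True
  then have z: "z > 0" using assms by simp
  \<comment> \<open>The rational bound on the logarithm, taken at \<open>t = y / z\<close>.\<close>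
  have "y * ((y / z - 1) * (5 * (y / z) + 1) / (2 * (y / z) * (y / z + 2))) \<le> y * ln (y / z)"
    using True z by (intro mult_left_mono ln_ge_rational) auto
  moreover have "y * ((y / z - 1) * (5 * (y / z) + 1) / (2 * (y / z) * (y / z + 2)))
      = (y - z) * (5 * y + z) / (2 * (y + 2 * z))"
    using True z by (simp add: divide_simps)
  moreover have "(y - z) * (5 * y + z) / (2 * (y + 2 * z)) - y + z
      = 3 / 2 * ((y - z)\<^sup>2 / (y + 2 * z))"
  proof -
    have "y + 2 * z \<noteq> 0" using True z by simp
    then show ?thesis
      by (simp add: divide_simps) (simp add: algebra_simps power2_eq_square)
  qed
  ultimately show ?thesis by linarith
next
  case False
  then have "y = 0" using assms by simp
  \<comment> \<open>For \<open>z > 0\<close> the claim becomes \<open>3 / 4 * z \<le> z\<close>; for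
    \<open>z = 0\<close> it holds because 0 / 0 = 0.\<close>
  then show ?thesis using assms by (cases "z = 0") (auto simp: power2_eq_square)
qed

text \<open>Expanding the square leaves
  \<open>2 * y - 2 * sqrt y * sqrt z \<le> y * ln (y / z)\<close>, which is
  \<open>ln u \<le> u - 1\<close> at \<open>u = sqrt (z / y)\<close>, multiplied by
  \<open>2 * y\<close>. For \<open>y = 0\<close> both sides equal \<open>z\<close>.\<close>

lemma kl_term_ge_hellinger:
  fixes y z :: real
  assumes "y \<ge> 0" "z \<ge> 0" "y > 0 \<Longrightarrow> z > 0"
  shows "(sqrt y - sqrt z)\<^sup>2 \<le> y * ln (y / z) - y + z"
proof (cases "y > 0")
  case True
  then have z: "z > 0" using assms by simp
  have "ln (z / y) = 2 * ln (sqrt (z / y))"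
    using True z by (simp add: ln_sqrt)
  also have "\<dots> \<le> 2 * (sqrt (z / y) - 1)"
    using True z by (intro mult_left_mono ln_le_minus_one) auto
  finally have "y * ln (z / y) \<le> y * (2 * (sqrt (z / y) - 1))"
    using True by simp
  also have "\<dots> = 2 * (sqrt y * sqrt z) - 2 * y"
  proof -
    have "sqrt y * sqrt z = (sqrt y * sqrt y) * (sqrt z / sqrt y)"
      using True by (simp del: real_sqrt_mult_self)
    then have "y * sqrt (z / y) = sqrt y * sqrt z"
      using True by (simp add: real_sqrt_divide)
    then show ?thesis by (simp add: algebra_simps)
  qed
  finally have "2 * y - 2 * (sqrt y * sqrt z) \<le> y * ln (y / z)"
    using True z by (simp add: ln_div algebra_simps)
  then show ?thesis
    using True z by (simp add: power2_diff)
qed (use assms in auto)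

text \<open>The left side is twice the negative part of \<open>y * ln (y / z)\<close>. It is nonzero
  only for \<open>0 < y < z\<close>, where \<open>y * ln (z / y) \<le> z - y\<close>. The right side
  is twice the positive part of \<open>z - y\<close>, written so that \<open>z - y\<close> cancels
  on summation.\<close>

lemma kl_term_abs_le:
  fixes y z :: real
  assumes "y \<ge> 0" "z \<ge> 0" "y > 0 \<Longrightarrow> z > 0"
  shows "y * \<bar>ln (y / z)\<bar> - y * ln (y / z) \<le> \<bar>y - z\<bar> + (z - y)"
proof (cases "y > 0 \<and> ln (y / z) < 0")
  case True
  then have z: "z > 0" using assms by simp
  have "y * ln (z / y) \<le> y * (z / y - 1)"
    using True z by (intro mult_left_mono ln_le_minus_one) auto
  also have "\<dots> = z - y" using True by (simp add: field_simps)
  also have "ln (z / y) = - ln (y / z)" using True z by (simp add: ln_div)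
  finally have "y * \<bar>ln (y / z)\<bar> - y * ln (y / z) \<le> 2 * (z - y)"
    using True by (simp add: abs_of_neg del: ln_div)
  also have "\<dots> \<le> \<bar>y - z\<bar> + (z - y)"
    using abs_ge_minus_self[of "y - z"] by simp
  finally show ?thesis .
next
  case False
  then have "y = 0 \<or> \<bar>ln (y / z)\<bar> = ln (y / z)" using assms by auto
  then have "y * \<bar>ln (y / z)\<bar> - y * ln (y / z) = 0" by auto
  then show ?thesis by linarith
qed

text \<open>\<open>y\<close> and \<open>z\<close> model the predictions of the true and the
  approximating distribution after one fixed history. \<open>y_pos_imp\<close> is absolute
  continuity: it makes the real-valued sum with total \<open>ln\<close> the true relative
  entropy.\<close>

locale finite_distributions =
  fixes y z :: "'a::finite \<Rightarrow> real"
  assumes y_nonneg: "y x \<ge> 0" and z_nonneg: "z x \<ge> 0"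
    and y_pos_imp: "y x > 0 \<Longrightarrow> z x > 0"
    and sum_y: "(\<Sum>x\<in>UNIV. y x) = 1" and sum_z: "(\<Sum>x\<in>UNIV. z x) = 1"
begin

text \<open>Both distributions have mass 1, so the correction sums to 0. It makes every summand
  non-negative, which permits comparison term by term.\<close>

lemma kl_eq: "(\<Sum>x\<in>UNIV. y x * ln (y x / z x)) = (\<Sum>x\<in>UNIV. y x * ln (y x / z x) - y x + z x)"
  by (simp add: sum.distrib sum_subtractf sum_y sum_z)

text \<open>Cauchy-Schwarz with the weights \<open>y x + 2 * z x\<close> reduces the claim to the
  quadratic bound on each summand.\<close>

lemma pinsker: "(\<Sum>x\<in>UNIV. \<bar>y x - z x\<bar>)\<^sup>2 \<le> 2 * (\<Sum>x\<in>UNIV. y x * ln (y x / z x))"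
proof -
  let ?u = "\<lambda>x. sqrt (y x + 2 * z x)" and ?v = "\<lambda>x. \<bar>y x - z x\<bar> / sqrt (y x + 2 * z x)"
  have w: "0 \<le> y x + 2 * z x" for x
    using y_nonneg[of x] z_nonneg[of x] by simp
  have uv: "?u x * ?v x = \<bar>y x - z x\<bar>" for x
  proof (cases "y x + 2 * z x = 0")
    case True
    then have "y x = 0" "z x = 0" using y_nonneg[of x] z_nonneg[of x] by linarith+
    then show ?thesis by simp
  qed simp
  have "(\<Sum>x\<in>UNIV. \<bar>y x - z x\<bar>)\<^sup>2 = (\<Sum>x\<in>UNIV. ?u x * ?v x)\<^sup>2"
    by (simp only: uv)
  also have "\<dots> \<le> (\<Sum>x\<in>UNIV. (?u x)\<^sup>2) * (\<Sum>x\<in>UNIV. (?v x)\<^sup>2)"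
    by (rule Cauchy_Schwarz_ineq_sum)
  \<comment> \<open>The weights have total mass 1 + 2 = 3.\<close>
  also have "\<dots> = 3 * (\<Sum>x\<in>UNIV. (y x - z x)\<^sup>2 / (y x + 2 * z x))"
    using w by (simp add: power_divide sum.distrib sum_y sum_z flip: sum_distrib_left)
  also have "\<dots> = 2 * (\<Sum>x\<in>UNIV. 3 / 2 * ((y x - z x)\<^sup>2 / (y x + 2 * z x)))"
    unfolding sum_distrib_left[symmetric] by simp
  also have "\<dots> \<le> 2 * (\<Sum>x\<in>UNIV. y x * ln (y x / z x) - y x + z x)"
    by (intro mult_left_mono sum_mono kl_term_ge_quadratic y_nonneg z_nonneg y_pos_imp) auto
  finally show ?thesis by (simp only: kl_eq)
qed

text \<open>The differences \<open>y x - z x\<close> sum to 0, so none exceeds half of the total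
  variation \<open>?a\<close> in absolute value. Replacing one factor of each square by
  \<open>?a / 2\<close> leaves half of what Pinsker's inequality bounds.\<close>

lemma square_distance_le_kl:
  "(\<Sum>x\<in>UNIV. (y x - z x)\<^sup>2) \<le> (\<Sum>x\<in>UNIV. y x * ln (y x / z x))"
proof -
  let ?a = "\<Sum>x\<in>UNIV. \<bar>y x - z x\<bar>"
  have half: "\<bar>y x - z x\<bar> \<le> ?a / 2" for x
  proof -
    have "(\<Sum>u\<in>UNIV. y u - z u) = 0"
      by (simp add: sum_subtractf sum_y sum_z)
    then have "y x - z x = - (\<Sum>u\<in>UNIV - {x}. y u - z u)"
      by (simp add: sum.remove[of UNIV x])
    also have "\<bar>\<dots>\<bar> \<le> (\<Sum>u\<in>UNIV - {x}. \<bar>y u - z u\<bar>)"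
      by (simp add: sum_abs)
    also have "\<dots> = ?a - \<bar>y x - z x\<bar>"
      by (simp add: sum.remove[of UNIV x])
    finally show ?thesis by simp
  qed
  have "(\<Sum>x\<in>UNIV. (y x - z x)\<^sup>2) = (\<Sum>x\<in>UNIV. \<bar>y x - z x\<bar> * \<bar>y x - z x\<bar>)"
    by (simp add: power2_eq_square)
  also have "\<dots> \<le> (\<Sum>x\<in>UNIV. ?a / 2 * \<bar>y x - z x\<bar>)"
    by (intro sum_mono mult_right_mono half) auto
  also have "\<dots> = ?a\<^sup>2 / 2"
    unfolding sum_distrib_left[symmetric] by (simp add: power2_eq_square)
  finally show ?thesis using pinsker by simp
qed

lemma hellinger_le_kl:
  "(\<Sum>x\<in>UNIV. (sqrt (y x) - sqrt (z x))\<^sup>2) \<le> (\<Sum>x\<in>UNIV. y x * ln (y x / z x))"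
  unfolding kl_eq by (intro sum_mono kl_term_ge_hellinger y_nonneg z_nonneg y_pos_imp)

lemma kl_abs_le:
  "(\<Sum>x\<in>UNIV. y x * \<bar>ln (y x / z x)\<bar>) - (\<Sum>x\<in>UNIV. y x * ln (y x / z x))
    \<le> (\<Sum>x\<in>UNIV. \<bar>y x - z x\<bar>)"
proof -
  have "(\<Sum>x\<in>UNIV. y x * \<bar>ln (y x / z x)\<bar> - y x * ln (y x / z x))
      \<le> (\<Sum>x\<in>UNIV. \<bar>y x - z x\<bar> + (z x - y x))"
    by (intro sum_mono kl_term_abs_le y_nonneg z_nonneg y_pos_imp)
  then show ?thesis
    by (simp add: sum_subtractf sum.distrib sum_y sum_z)
qed

text \<open>The summands agree wherever \<open>y x > 0\<close>. Where \<open>y x = 0\<close> the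
  left one is 0 and the right one is \<open>z x\<close>.\<close>

lemma ratio_hellinger_le:
  "(\<Sum>x\<in>UNIV. y x * (sqrt (z x / y x) - 1)\<^sup>2) \<le> (\<Sum>x\<in>UNIV. (sqrt (y x) - sqrt (z x))\<^sup>2)"
proof (rule sum_mono)
  fix x
  show "y x * (sqrt (z x / y x) - 1)\<^sup>2 \<le> (sqrt (y x) - sqrt (z x))\<^sup>2"
  proof (cases "y x = 0")
    case False
    then have pos: "y x > 0" using y_nonneg[of x] by simp
    have "y x * (sqrt (z x / y x) - 1)\<^sup>2 = (sqrt (y x) * (sqrt (z x / y x) - 1))\<^sup>2"
      using pos by (simp add: power_mult_distrib)
    also have "sqrt (y x) * (sqrt (z x / y x) - 1) = sqrt (z x) - sqrt (y x)"
      using pos by (simp add: real_sqrt_divide right_diff_distrib)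
    finally show ?thesis by (simp add: power2_commute)
  qed simp
qed

end

subsection \<open>Expectations of functions of finite prefixes\<close>

lemma AE_tendsto_0_of_bounded_sum_integrals:
  fixes f :: "nat \<Rightarrow> 'b \<Rightarrow> real"
  assumes int: "\<And>n. integrable M (f n)"
    and nonneg: "\<And>n. AE x in M. 0 \<le> f n x"
    and bound: "\<And>n. (\<Sum>k<n. \<integral>x. f k x \<partial>M) \<le> C"
  shows "AE x in M. (\<lambda>n. f n x) \<longlonglongrightarrow> 0"
proof -
  have [measurable]: "f n \<in> borel_measurable M" for n
    using int by auto
  have I_nonneg: "0 \<le> (\<integral>x. f k x \<partial>M)" for k
    using nonneg by (intro integral_nonneg_AE)
  then have summ: "summable (\<lambda>k. \<integral>x. f k x \<partial>M)"
    by (intro bounded_imp_summable[of _ C]) (simp_all only: bound flip: lessThan_Suc_atMost)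
  \<comment> \<open>In \<open>ennreal\<close> the series exists before its convergence is known, and
    sum and integral commute; \<open>ennreal\<close> sends negative values on the exceptional null
    set to 0.\<close>
  have "(\<integral>\<^sup>+x. (\<Sum>k. ennreal (f k x)) \<partial>M) = (\<Sum>k. \<integral>\<^sup>+x. ennreal (f k x) \<partial>M)"
    by (rule nn_integral_suminf) simp
  also have "\<dots> = (\<Sum>k. ennreal (\<integral>x. f k x \<partial>M))"
    by (intro suminf_cong nn_integral_eq_integral int nonneg)
  also have "\<dots> = ennreal (\<Sum>k. \<integral>x. f k x \<partial>M)"
    using summ I_nonneg by (intro suminf_ennreal_eq summable_sums)
  finally have "(\<integral>\<^sup>+x. (\<Sum>k. ennreal (f k x)) \<partial>M) \<noteq> \<infinity>" by simp
  then have "AE x in M. (\<Sum>k. ennreal (f k x)) \<noteq> \<infinity>"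
    by (intro nn_integral_PInf_AE) auto
  moreover have "AE x in M. \<forall>n. 0 \<le> f n x"
    using nonneg by (simp add: AE_all_countable)
  ultimately show ?thesis
  proof eventually_elim
    case (elim x)
    then have "summable (\<lambda>k. f k x)"
      by (intro summable_suminf_not_top) auto
    then show ?case by (rule summable_LIMSEQ_zero)
  qed
qed

lemma sum_lists_length_Suc:
  fixes g :: "'a::finite list \<Rightarrow> 'b::comm_monoid_add"
  shows "(\<Sum>h | length h = Suc n. g h) = (\<Sum>h | length h = n. \<Sum>x\<in>UNIV. g (h @ [x]))"
proof -
  have "(\<Sum>h | length h = Suc n. g h) = (\<Sum>(h, x)\<in>{h. length h = n} \<times> UNIV. g (h @ [x]))"
    by (rule sum.reindex_bij_witness[of _ "\<lambda>(h, x). h @ [x]" "\<lambda>h. (butlast h, last h)"])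
       (auto simp: length_Suc_conv_rev)
  then show ?thesis by (simp add: sum.cartesian_product)
qed

locale stream_prob_space = prob_space \<mu> for \<mu> :: "'a::finite stream measure" +
  assumes sets_eq: "sets \<mu> = sets (stream_space (count_space UNIV))"
begin

abbreviation p :: "'a list \<Rightarrow> real" where "p \<equiv> prefix_prob \<mu>"

lemma space_eq: "space \<mu> = UNIV"
  using sets_eq_imp_space_eq[OF sets_eq] by (simp add: space_stream_space)

lemma measurable_stake [measurable]: "stake n \<in> measurable \<mu> (count_space UNIV)"
  by (subst measurable_cong_sets[OF sets_eq refl]) (rule measurable_stake)

lemma measurable_snth [measurable]: "(\<lambda>\<omega>. \<omega> !! n) \<in> measurable \<mu> (count_space UNIV)"
  by (subst measurable_cong_sets[OF sets_eq refl]) (rule measurable_snth)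

lemma measurable_prefix_set: "{\<omega>. stake n \<omega> = h} \<in> sets \<mu>"
  using measurable_sets[OF measurable_stake, of "{h}" n] by (simp add: space_eq vimage_def)

lemma p_eq: "p h = prob {\<omega>. stake (length h) \<omega> = h}"
  by (simp add: prefix_prob_def space_eq)

lemma p_nonneg: "0 \<le> p h"
  by (simp add: p_eq)

lemma p_Nil: "p [] = 1"
  using prob_space by (simp add: p_eq space_eq)

text \<open>The cylinder set of \<open>h\<close> is the disjoint union of the cylinder sets of its
  one-symbol extensions.\<close>

lemma p_snoc: "(\<Sum>x\<in>UNIV. p (h @ [x])) = p h"
proof -
  have eq: "{\<omega>. stake (length h) \<omega> = h} = (\<Union>x. {\<omega>. stake (Suc (length h)) \<omega> = h @ [x]})"
    by (auto simp: stake_Suc simp del: stake.simps)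
  show ?thesis
    unfolding p_eq eq length_append_singleton
    by (rule finite_measure_finite_Union[symmetric])
       (auto simp: disjoint_family_on_def measurable_prefix_set simp del: stake.simps)
qed

lemma p_snoc_le: "p (h @ [x]) \<le> p h"
  using member_le_sum[of x UNIV "\<lambda>x. p (h @ [x])"] by (simp add: p_snoc p_nonneg)

text \<open>The alphabet is finite, so a function of the first \<open>n\<close> symbols is a simple
  function: integrable, with a finite sum over strings as its expectation.\<close>

lemma has_integral_stake:
  "has_bochner_integral \<mu> (\<lambda>\<omega>. f (stake n \<omega>)) (\<Sum>h | length h = n. p h * f h)"
    for f :: "'a list \<Rightarrow> real"
proof -
  have fin: "finite {h :: 'a list. length h = n}"
    using finite_lists_length_eq[of "UNIV :: 'a set" n] by simp
  have "has_bochner_integral \<mu>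
      (\<lambda>\<omega>. \<Sum>h | length h = n. indicator {\<omega>. stake n \<omega> = h} \<omega> * f h)
      (\<Sum>h | length h = n. p h * f h)"
    by (intro has_bochner_integral_sum has_bochner_integral_mult_left)
       (auto simp: p_eq intro!: has_bochner_integral_real_indicator measurable_prefix_set
          emeasure_finite simp: less_top[symmetric])
  moreover have "(\<Sum>h | length h = n. indicator {\<omega>. stake n \<omega> = h} \<omega> * f h) = f (stake n \<omega>)" for \<omega>
    using fin by (subst sum.mono_neutral_right[of _ "{stake n \<omega>}"]) auto
  ultimately show ?thesis by simp
qed

lemmas integrable_stake = has_integral_stake[THEN integrable.intros]
  and integral_stake = has_integral_stake[THEN has_bochner_integral_integral_eq]

text \<open>Strings of probability 0 carry weight 0 in the expectation, so junk values from division
  by 0 do not disturb the comparison.\<close>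

lemma integral_stake_mono:
  fixes f g :: "'a list \<Rightarrow> real"
  assumes "\<And>h. p h > 0 \<Longrightarrow> f h \<le> g h"
  shows "(\<integral>\<omega>. f (stake n \<omega>) \<partial>\<mu>) \<le> (\<integral>\<omega>. g (stake n \<omega>) \<partial>\<mu>)"
  unfolding integral_stake
proof (rule sum_mono)
  fix h show "p h * f h \<le> p h * g h"
    using assms[of h] p_nonneg[of h] by (cases "p h = 0") (auto intro: mult_left_mono)
qed

lemma AE_stake_pos: "AE \<omega> in \<mu>. p (stake n \<omega>) > 0"
proof -
  have *: "(\<integral>\<omega>. of_bool (p (stake n \<omega>) = 0) \<partial>\<mu>) = (0::real)"
    by (subst integral_stake[of "\<lambda>h. of_bool (p h = 0)"]) (auto intro: sum.neutral)
  have "AE \<omega> in \<mu>. of_bool (p (stake n \<omega>) = 0) = (0::real)"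
    using * integral_nonneg_eq_0_iff_AE[OF integrable_stake[of "\<lambda>h. of_bool (p h = 0)" n]] by auto
  then show ?thesis
    by eventually_elim (use p_nonneg in \<open>auto simp: less_le\<close>)
qed

text \<open>History and next symbol together are the prefix of length \<open>Suc n\<close>, split by
  \<open>butlast\<close> and \<open>last\<close>.\<close>

lemma has_integral_stake_snth:
  fixes f :: "'a list \<Rightarrow> 'a \<Rightarrow> real"
  shows "has_bochner_integral \<mu> (\<lambda>\<omega>. f (stake n \<omega>) (\<omega> !! n))
    (\<Sum>h | length h = n. \<Sum>x\<in>UNIV. p (h @ [x]) * f h x)"
proof -
  have "f (stake n \<omega>) (\<omega> !! n) = f (butlast (stake (Suc n) \<omega>)) (last (stake (Suc n) \<omega>))" for \<omega>
    by (simp add: stake_Suc del: stake.simps)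
  then show ?thesis
    using has_integral_stake[of "\<lambda>h. f (butlast h) (last h)" "Suc n"]
    by (simp add: sum_lists_length_Suc del: stake.simps)
qed

end

lemma has_sum_sum_finite:
  fixes f :: "'i \<Rightarrow> 'b \<Rightarrow> 'c::topological_comm_monoid_add"
  assumes "finite I" "\<And>i. i \<in> I \<Longrightarrow> (f i has_sum s i) A"
  shows "((\<lambda>x. \<Sum>i\<in>I. f i x) has_sum (\<Sum>i\<in>I. s i)) A"
  using assms by (induction I rule: finite_induct) (auto intro: has_sum_add)

subsection \<open>Predictors that dominate the true distribution\<close>

text \<open>Isolates what the argument uses of the mixture: domination of the true distribution,
  here with constant \<open>c\<close>, and consistency of its values on strings.\<close>

locale dominating_predictor = stream_prob_space \<mu> for \<mu> :: "'a::finite stream measure" +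
  fixes q :: "'a list \<Rightarrow> real" and c :: real
  assumes c_pos: "c > 0"
    and dominates: "c * p h \<le> q h"
    and q_Nil: "q [] = 1"
    and q_snoc: "(\<Sum>x\<in>UNIV. q (h @ [x])) = q h"
begin

abbreviation ratio :: "'a list \<Rightarrow> 'a \<Rightarrow> real" where
  "ratio h x \<equiv> predict q h x / predict p h x"

lemma q_nonneg: "0 \<le> q h"
  using dominates[of h] c_pos p_nonneg[of h] by (smt (verit) mult_nonneg_nonneg)

lemma q_pos: "p h > 0 \<Longrightarrow> q h > 0"
  using dominates[of h] c_pos by (smt (verit) mult_pos_pos)

lemma predict_nonneg: "0 \<le> predict p h x" "0 \<le> predict q h x"
  by (simp_all add: predict_def p_nonneg q_nonneg)

text \<open>This covers null histories: there \<open>p (h @ [x])\<close> is 0 as well.\<close>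

lemma p_times_predict: "p h * predict p h x = p (h @ [x])"
  using p_snoc_le[of h x] p_nonneg[of "h @ [x]"] by (auto simp: predict_def)

lemma finite_distributions_predict:
  assumes "p h > 0"
  shows "finite_distributions (predict p h) (predict q h)"
proof
  show "predict q h x > 0" if "predict p h x > 0" for x
    using that assms q_pos[of h] q_pos[of "h @ [x]"] by (auto simp: predict_def zero_less_divide_iff)
qed (use assms q_pos[of h] in
      \<open>simp_all add: predict_def p_nonneg q_nonneg p_snoc q_snoc flip: sum_divide_distrib\<close>)

section \<open>Instantaneous distances after a fixed history\<close>

lemma dist_inequalities:
  assumes "p h > 0"
  shows dist_s_le_dist_d: "dist_s p q h \<le> dist_d p q h"
    and dist_h_le_dist_d: "dist_h p q h \<le> dist_d p q h"
    and dist_a_squared_le: "(dist_a p q h)\<^sup>2 \<le> 2 * dist_d p q h"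
    and dist_b_minus_dist_d_le: "dist_b p q h - dist_d p q h \<le> dist_a p q h"
    and expected_ratio_le: "(\<Sum>x\<in>UNIV. predict p h x * (sqrt (ratio h x) - 1)\<^sup>2) \<le> dist_h p q h"
proof -
  interpret finite_distributions "predict p h" "predict q h"
    by (rule finite_distributions_predict[OF assms])
  show "dist_s p q h \<le> dist_d p q h"
    unfolding dist_s_def dist_d_def by (rule square_distance_le_kl)
  show "dist_h p q h \<le> dist_d p q h"
    unfolding dist_h_def dist_d_def by (rule hellinger_le_kl)
  show "(dist_a p q h)\<^sup>2 \<le> 2 * dist_d p q h"
    unfolding dist_a_def dist_d_def by (rule pinsker)
  show "dist_b p q h - dist_d p q h \<le> dist_a p q h"
    unfolding dist_a_def dist_b_def dist_d_def by (rule kl_abs_le)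
  show "(\<Sum>x\<in>UNIV. predict p h x * (sqrt (ratio h x) - 1)\<^sup>2) \<le> dist_h p q h"
    unfolding dist_h_def by (rule ratio_hellinger_le)
qed

lemma dist_d_nonneg: "p h > 0 \<Longrightarrow> 0 \<le> dist_d p q h"
  using dist_s_le_dist_d[of h] by (smt (verit) dist_s_def sum_nonneg zero_le_power2)

lemma square_diff_le_dist_d:
  "p h > 0 \<Longrightarrow> (predict q h x - predict p h x)\<^sup>2 \<le> dist_d p q h"
  using member_le_sum[of x UNIV "\<lambda>x. (predict p h x - predict q h x)\<^sup>2"] dist_s_le_dist_d[of h]
  by (simp add: dist_s_def power2_commute)

section \<open>Total relative entropy\<close>

lemma total_dist_eq: "total_dist \<mu> f n = (\<Sum>k<n. \<integral>\<omega>. f (stake k \<omega>) \<partial>\<mu>)"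
  by (simp add: total_dist_def sum.atLeast1_atMost_eq)

lemma total_dist_mono:
  "(\<And>h. p h > 0 \<Longrightarrow> f h \<le> g h) \<Longrightarrow> total_dist \<mu> f n \<le> total_dist \<mu> g n"
  unfolding total_dist_eq by (intro sum_mono integral_stake_mono)

text \<open>The log-ratio of a string is the sum of the log-ratios of its one-step predictions, so
  the sum telescopes along each string.\<close>

lemma chain_rule: "total_dist \<mu> (dist_d p q) n = (\<Sum>h | length h = n. p h * ln (p h / q h))"
proof (induction n)
  case 0
  then show ?case by (simp add: total_dist_eq p_Nil q_Nil)
next
  case (Suc n)
  \<comment> \<open>Distribute \<open>p h\<close> over the extensions by \<open>p_snoc\<close>, then
    add the two logarithms symbol by symbol; extensions of probability 0 contribute 0 on both
    sides.\<close>
  have step: "p h * dist_d p q h + p h * ln (p h / q h)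
      = (\<Sum>x\<in>UNIV. p (h @ [x]) * ln (p (h @ [x]) / q (h @ [x])))" for h
  proof -
    have *: "p h * (predict p h x * ln (predict p h x / predict q h x)) + p (h @ [x]) * ln (p h / q h)
        = p (h @ [x]) * ln (p (h @ [x]) / q (h @ [x]))" for x
    proof (cases "p (h @ [x]) = 0")
      case False
      then have "p (h @ [x]) > 0" using p_nonneg[of "h @ [x]"] by simp
      moreover from this have "p h > 0" using p_snoc_le[of h x] by simp
      ultimately have "ln (predict p h x / predict q h x) + ln (p h / q h)
          = ln (p (h @ [x]) / q (h @ [x]))"
        using q_pos[of h] q_pos[of "h @ [x]"] by (simp add: predict_def ln_div ln_mult)
      then show ?thesis
        by (simp add: p_times_predict flip: mult.assoc distrib_left)
    qed (simp add: predict_def)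
    show ?thesis
      unfolding *[symmetric] sum.distrib sum_distrib_left[symmetric] sum_distrib_right[symmetric]
        p_snoc dist_d_def ..
  qed
  have "total_dist \<mu> (dist_d p q) (Suc n)
      = (\<Sum>h | length h = n. p h * ln (p h / q h)) + (\<Sum>h | length h = n. p h * dist_d p q h)"
    using Suc by (simp add: total_dist_eq integral_stake)
  also have "\<dots> = (\<Sum>h | length h = n. p h * dist_d p q h + p h * ln (p h / q h))"
    by (simp add: sum.distrib)
  also have "\<dots> = (\<Sum>h | length h = Suc n. p h * ln (p h / q h))"
    by (simp only: step sum_lists_length_Suc)
  finally show ?case .
qed

text \<open>Domination gives \<open>p h / q h \<le> inverse c\<close> on every string of positive
  probability, whatever its length.\<close>

lemma total_d_le: "total_dist \<mu> (dist_d p q) n \<le> ln (inverse c)"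
proof -
  have "p h * ln (p h / q h) \<le> p h * ln (inverse c)" for h
  proof (cases "p h = 0")
    case False
    then have "p h > 0" using p_nonneg[of h] by simp
    then show ?thesis
      using dominates[of h] q_pos[of h] c_pos
      by (intro mult_left_mono) (auto simp: field_simps)
  qed simp
  then have "total_dist \<mu> (dist_d p q) n \<le> (\<Sum>h | length h = n. p h * ln (inverse c))"
    unfolding chain_rule by (intro sum_mono)
  \<comment> \<open>The probabilities of the strings of length \<open>n\<close> sum to 1; this is
    read off from the expectation of a constant.\<close>
  also have "\<dots> = ln (inverse c)"
    using integral_stake[of "\<lambda>_. ln (inverse c)" n] by (simp add: prob_space)
  finally show ?thesis .
qed

section \<open>Convergence of the predictions\<close>

lemma AE_dist_d_tendsto_0: "AE \<omega> in \<mu>. (\<lambda>n. dist_d p q (stake n \<omega>)) \<longlonglongrightarrow> 0"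
proof (rule AE_tendsto_0_of_bounded_sum_integrals)
  show "AE \<omega> in \<mu>. 0 \<le> dist_d p q (stake n \<omega>)" for n
    using AE_stake_pos[of n] by eventually_elim (rule dist_d_nonneg)
  show "(\<Sum>k<n. \<integral>\<omega>. dist_d p q (stake k \<omega>) \<partial>\<mu>) \<le> ln (inverse c)" for n
    using total_d_le by (simp add: total_dist_eq)
qed (rule integrable_stake)

lemma summable_integral_dist_d: "summable (\<lambda>n. \<integral>\<omega>. dist_d p q (stake n \<omega>) \<partial>\<mu>)"
proof (rule bounded_imp_summable)
  show "0 \<le> (\<integral>\<omega>. dist_d p q (stake n \<omega>) \<partial>\<mu>)" for n
    using integral_stake_mono[of "\<lambda>_. 0" "dist_d p q" n] dist_d_nonneg by simp
  show "(\<Sum>k\<le>n. \<integral>\<omega>. dist_d p q (stake k \<omega>) \<partial>\<mu>) \<le> ln (inverse c)" for n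
    using total_d_le[of "Suc n"] by (simp only: total_dist_eq lessThan_Suc_atMost)
qed

text \<open>The bound of the squared difference by \<open>dist_d\<close> is uniform in the symbol.
  The symbol may therefore depend on the whole sequence, its future included.\<close>

lemma AE_predict_diff_tendsto_0:
  "AE \<omega> in \<mu>. (\<lambda>n. predict q (stake n \<omega>) (x n \<omega>) - predict p (stake n \<omega>) (x n \<omega>)) \<longlonglongrightarrow> 0"
proof -
  have "AE \<omega> in \<mu>. \<forall>n. p (stake n \<omega>) > 0"
    by (simp add: AE_all_countable AE_stake_pos)
  with AE_dist_d_tendsto_0 show ?thesis
  proof eventually_elim
    case (elim \<omega>)
    have "(\<lambda>n. (predict q (stake n \<omega>) (x n \<omega>) - predict p (stake n \<omega>) (x n \<omega>))\<^sup>2) \<longlonglongrightarrow> 0"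
      by (rule tendsto_sandwich[OF _ _ tendsto_const elim(1)])
         (use elim(2) in \<open>simp_all add: square_diff_le_dist_d\<close>)
    then show ?case by simp
  qed
qed

lemma predict_diff_in_mean_sum:
  assumes [measurable]: "\<And>n. x n \<in> measurable \<mu> (count_space UNIV)"
  defines "e \<equiv> \<lambda>n \<omega>. (predict q (stake n \<omega>) (x n \<omega>) - predict p (stake n \<omega>) (x n \<omega>))\<^sup>2"
  shows "integrable \<mu> (e n)" and "summable (\<lambda>n. \<integral>\<omega>. e n \<omega> \<partial>\<mu>)"
proof -
  have meas: "e n \<in> borel_measurable \<mu>" for n
    unfolding e_def
    \<comment> \<open>There are countably many histories, so it suffices to check measurability with
      the history held fixed.\<close>
    by (rule measurable_compose_countable[where g = "stake n" and
          f = "\<lambda>h \<omega>. (predict q h (x n \<omega>) - predict p h (x n \<omega>))\<^sup>2"])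
       (auto intro: measurable_compose[OF assms(1)])
  have le: "AE \<omega> in \<mu>. e n \<omega> \<le> dist_d p q (stake n \<omega>)" for n
    using AE_stake_pos[of n] by eventually_elim (auto simp: e_def square_diff_le_dist_d)
  show int: "integrable \<mu> (e n)" for n
  proof (rule Bochner_Integration.integrable_bound[OF integrable_stake[of "dist_d p q" n] meas])
    show "AE \<omega> in \<mu>. norm (e n \<omega>) \<le> norm (dist_d p q (stake n \<omega>))"
      using le[of n] by eventually_elim (simp add: e_def)
  qed
  show "summable (\<lambda>n. \<integral>\<omega>. e n \<omega> \<partial>\<mu>)"
  proof (rule summable_comparison_test'[OF summable_integral_dist_d])
    fix n
    have "0 \<le> (\<integral>\<omega>. e n \<omega> \<partial>\<mu>)"
      by (intro integral_nonneg_AE) (simp add: e_def)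
    moreover have "(\<integral>\<omega>. e n \<omega> \<partial>\<mu>) \<le> (\<integral>\<omega>. dist_d p q (stake n \<omega>) \<partial>\<mu>)"
      by (intro integral_mono_AE int integrable_stake le)
    ultimately show "norm (\<integral>\<omega>. e n \<omega> \<partial>\<mu>) \<le> (\<integral>\<omega>. dist_d p q (stake n \<omega>) \<partial>\<mu>)"
      by simp
  qed
qed

section \<open>The ratio at the drawn symbol\<close>

lemmas integrable_ratio = has_integral_stake_snth[THEN integrable.intros,
    of "\<lambda>h x. (sqrt (ratio h x) - 1)\<^sup>2"]

text \<open>Given the history \<open>h\<close>, the drawn symbol has distribution
  \<open>predict p h\<close>. Averaging over it first turns the left side into the expectation of
  the sum bounded in \<open>expected_ratio_le\<close>.\<close>

lemma integral_ratio_le: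
  "(\<integral>\<omega>. (sqrt (ratio (stake n \<omega>) (\<omega> !! n)) - 1)\<^sup>2 \<partial>\<mu>) \<le> (\<integral>\<omega>. dist_h p q (stake n \<omega>) \<partial>\<mu>)"
proof -
  have "(\<integral>\<omega>. (sqrt (ratio (stake n \<omega>) (\<omega> !! n)) - 1)\<^sup>2 \<partial>\<mu>)
      = (\<Sum>h | length h = n. p h * (\<Sum>x\<in>UNIV. predict p h x * (sqrt (ratio h x) - 1)\<^sup>2))"
    by (subst has_integral_stake_snth[THEN has_bochner_integral_integral_eq,
          of "\<lambda>h x. (sqrt (ratio h x) - 1)\<^sup>2"])
       (simp add: sum_distrib_left p_times_predict flip: mult.assoc)
  also have "\<dots> = (\<integral>\<omega>. (\<Sum>x\<in>UNIV. predict p (stake n \<omega>) x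
      * (sqrt (ratio (stake n \<omega>) x) - 1)\<^sup>2) \<partial>\<mu>)"
    by (rule integral_stake[symmetric])
  also have "\<dots> \<le> (\<integral>\<omega>. dist_h p q (stake n \<omega>) \<partial>\<mu>)"
    by (rule integral_stake_mono) (rule expected_ratio_le)
  finally show ?thesis .
qed

lemma sum_integral_ratio_le:
  "(\<Sum>k<n. \<integral>\<omega>. (sqrt (ratio (stake k \<omega>) (\<omega> !! k)) - 1)\<^sup>2 \<partial>\<mu>) \<le> total_dist \<mu> (dist_h p q) n"
  unfolding total_dist_eq by (intro sum_mono integral_ratio_le)

lemma total_h_le_total_d: "total_dist \<mu> (dist_h p q) n \<le> total_dist \<mu> (dist_d p q) n"
  by (intro total_dist_mono dist_h_le_dist_d)

lemma sum_integral_ratio_bounded: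
  "(\<Sum>k<n. \<integral>\<omega>. (sqrt (ratio (stake k \<omega>) (\<omega> !! k)) - 1)\<^sup>2 \<partial>\<mu>) \<le> ln (inverse c)"
  using sum_integral_ratio_le total_h_le_total_d total_d_le by (rule order_trans[OF order_trans])

lemma summable_integral_ratio:
  "summable (\<lambda>n. \<integral>\<omega>. (sqrt (ratio (stake n \<omega>) (\<omega> !! n)) - 1)\<^sup>2 \<partial>\<mu>)"
  by (rule bounded_imp_summable[of _ "ln (inverse c)"])
     (simp_all only: sum_integral_ratio_bounded Bochner_Integration.integral_nonneg zero_le_power2
        flip: lessThan_Suc_atMost)

lemma AE_ratio_tendsto_1: "AE \<omega> in \<mu>. (\<lambda>n. ratio (stake n \<omega>) (\<omega> !! n)) \<longlonglongrightarrow> 1"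
proof -
  have "AE \<omega> in \<mu>. (\<lambda>n. (sqrt (ratio (stake n \<omega>) (\<omega> !! n)) - 1)\<^sup>2) \<longlonglongrightarrow> 0"
    by (rule AE_tendsto_0_of_bounded_sum_integrals[OF integrable_ratio _ sum_integral_ratio_bounded])
       simp
  then show ?thesis
  proof eventually_elim
    case (elim \<omega>)
    then have "(\<lambda>n. sqrt (ratio (stake n \<omega>) (\<omega> !! n))) \<longlonglongrightarrow> 1"
      by (simp add: LIM_zero_iff)
    \<comment> \<open>Squaring the root returns the ratio itself, since the ratio is
      non-negative.\<close>
    from tendsto_power[OF this, of 2] show ?case
      by (simp add: predict_nonneg)
  qed
qed

section \<open>Total absolute distances\<close>

lemma total_b_minus_total_d_le:
  "total_dist \<mu> (dist_b p q) n - total_dist \<mu> (dist_d p q) n \<le> total_dist \<mu> (dist_a p q) n"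
proof -
  have "total_dist \<mu> (dist_b p q) n - total_dist \<mu> (dist_d p q) n
      = total_dist \<mu> (\<lambda>h. dist_b p q h - dist_d p q h) n"
    by (simp add: total_dist_eq integrable_stake flip: sum_subtractf)
  also have "\<dots> \<le> total_dist \<mu> (dist_a p q) n"
    by (intro total_dist_mono dist_b_minus_dist_d_le)
  finally show ?thesis .
qed

text \<open>Pinsker's inequality controls the squared expectation at each time; Cauchy-Schwarz
  against the constant 1 over the \<open>n\<close> time steps produces the factor
  \<open>n\<close>.\<close>

lemma total_a_le: "total_dist \<mu> (dist_a p q) n \<le> sqrt (2 * real n * total_dist \<mu> (dist_d p q) n)"
proof (rule real_le_rsqrt)
  have "(\<integral>\<omega>. dist_a p q (stake k \<omega>) \<partial>\<mu>)\<^sup>2 \<le> 2 * (\<integral>\<omega>. dist_d p q (stake k \<omega>) \<partial>\<mu>)" for k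
  proof -
    \<comment> \<open>Variance is non-negative.\<close>
    have "(\<integral>\<omega>. dist_a p q (stake k \<omega>) \<partial>\<mu>)\<^sup>2 \<le> (\<integral>\<omega>. (dist_a p q (stake k \<omega>))\<^sup>2 \<partial>\<mu>)"
      using variance_positive[of "\<lambda>\<omega>. dist_a p q (stake k \<omega>)"]
        variance_eq[OF integrable_stake[of "dist_a p q" k]
          integrable_stake[of "\<lambda>h. (dist_a p q h)\<^sup>2" k]] by simp
    also have "\<dots> \<le> (\<integral>\<omega>. 2 * dist_d p q (stake k \<omega>) \<partial>\<mu>)"
      by (intro integral_stake_mono dist_a_squared_le)
    finally show ?thesis by simp
  qed
  then have "(\<Sum>k<n. (\<integral>\<omega>. dist_a p q (stake k \<omega>) \<partial>\<mu>)\<^sup>2) \<le> 2 * total_dist \<mu> (dist_d p q) n"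
    unfolding total_dist_eq sum_distrib_left by (intro sum_mono)
  then have "real n * (\<Sum>k<n. (\<integral>\<omega>. dist_a p q (stake k \<omega>) \<partial>\<mu>)\<^sup>2)
      \<le> 2 * real n * total_dist \<mu> (dist_d p q) n"
    by (subst mult.assoc, subst mult.left_commute) (rule mult_left_mono, simp_all)
  moreover have "(total_dist \<mu> (dist_a p q) n)\<^sup>2
      \<le> real n * (\<Sum>k<n. (\<integral>\<omega>. dist_a p q (stake k \<omega>) \<partial>\<mu>)\<^sup>2)"
    using Cauchy_Schwarz_ineq_sum[of "\<lambda>_. 1" "\<lambda>k. \<integral>\<omega>. dist_a p q (stake k \<omega>) \<partial>\<mu>" "{..<n}"]
    by (simp add: total_dist_eq)
  ultimately show "(total_dist \<mu> (dist_a p q) n)\<^sup>2 \<le> 2 * real n * total_dist \<mu> (dist_d p q) n"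
    by linarith
qed

end

section \<open>The mixture and the final assembly\<close>

lemma dominating_predictor_mixture:
  fixes M :: "'a::finite stream measure set"
  assumes M: "\<forall>\<nu>\<in>M. prob_space \<nu> \<and> sets \<nu> = sets (stream_space (count_space UNIV))"
    and "\<mu> \<in> M"
    and pos: "\<forall>\<nu>\<in>M. w \<nu> > 0"
    and sum: "(w has_sum 1) M"
  shows "dominating_predictor \<mu> (mixture M w) (w \<mu>)"
proof -
  have stream: "stream_prob_space \<nu>" if "\<nu> \<in> M" for \<nu>
    using M that by (simp add: stream_prob_space_def stream_prob_space_axioms_def)
  interpret stream_prob_space \<mu> by (rule stream) fact
  have has_sum_mixture: "((\<lambda>\<nu>. w \<nu> * prefix_prob \<nu> h) has_sum mixture M w h) M" for h
  proof -
    have "(\<lambda>\<nu>. w \<nu> * prefix_prob \<nu> h) summable_on M"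
    \<comment> \<open>The weights themselves are a summable majorant, as prefix probabilities are at
      most 1.\<close>
    proof (rule summable_on_comparison_test[OF has_sum_imp_summable[OF sum]])
      fix \<nu> assume \<nu>: "\<nu> \<in> M"
      then interpret \<nu>: prob_space \<nu> using M by blast
      show "w \<nu> * prefix_prob \<nu> h \<le> w \<nu>" "0 \<le> w \<nu> * prefix_prob \<nu> h"
        using \<nu> pos by (auto simp: prefix_prob_def mult_left_le less_imp_le)
    qed
    then show ?thesis by (simp add: mixture_def)
  qed
  show ?thesis
  proof unfold_locales
    show "w \<mu> > 0" using pos \<open>\<mu> \<in> M\<close> by blast
    show "w \<mu> * prefix_prob \<mu> h \<le> mixture M w h" for h
      using assms by (intro mixture_dominates) auto
    have "((\<lambda>\<nu>. w \<nu> * prefix_prob \<nu> []) has_sum 1) M"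
      by (subst has_sum_cong[where g = w]) (auto simp: sum stream_prob_space.p_Nil[OF stream])
    then show "mixture M w [] = 1"
      unfolding mixture_def by (rule infsumI)
    show "(\<Sum>x\<in>UNIV. mixture M w (h @ [x])) = mixture M w h" for h
    \<comment> \<open>Consistency passes from the components to the mixture: one family over
      \<open>M\<close> is summed in two ways, by exchanging it with the finite sum over symbols and
      by applying \<open>p_snoc\<close> to each component.\<close>
    proof (rule has_sum_unique)
      show "((\<lambda>\<nu>. \<Sum>x\<in>UNIV. w \<nu> * prefix_prob \<nu> (h @ [x])) has_sum
          (\<Sum>x\<in>UNIV. mixture M w (h @ [x]))) M"
        by (intro has_sum_sum_finite has_sum_mixture) simp
      show "((\<lambda>\<nu>. \<Sum>x\<in>UNIV. w \<nu> * prefix_prob \<nu> (h @ [x])) has_sum mixture M w h) M"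
        by (subst has_sum_cong[where g = "\<lambda>\<nu>. w \<nu> * prefix_prob \<nu> h"])
           (auto simp: has_sum_mixture stream_prob_space.p_snoc[OF stream] simp flip: sum_distrib_left)
    qed
  qed
qed

theorem theorem1:
  fixes M :: "'a::finite stream measure set"
    and w :: "'a stream measure \<Rightarrow> real"
    and \<mu> :: "'a stream measure"
    and p \<xi> :: "'a list \<Rightarrow> real"
    and A S H D B :: "nat \<Rightarrow> real"
  assumes "countable M"
    and "\<forall>\<nu>\<in>M. prob_space \<nu> \<and> sets \<nu> = sets (stream_space (count_space UNIV))"
    and "\<mu> \<in> M"
    and "\<forall>\<nu>\<in>M. w \<nu> > 0"
    and "(w has_sum 1) M"
  defines "p \<equiv> prefix_prob \<mu>"
    and "\<xi> \<equiv> mixture M w"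
    and "A \<equiv> total_dist \<mu> (dist_a p \<xi>)"
    and "S \<equiv> total_dist \<mu> (dist_s p \<xi>)"
    and "H \<equiv> total_dist \<mu> (dist_h p \<xi>)"
    and "D \<equiv> total_dist \<mu> (dist_d p \<xi>)"
    and "B \<equiv> total_dist \<mu> (dist_b p \<xi>)"
  shows
    "(\<forall>n\<ge>1.
        (\<Sum>t=1..n. \<integral>\<omega>. (\<Sum>x'\<in>UNIV.
           (predict p (stake (t - 1) \<omega>) x' - predict \<xi> (stake (t - 1) \<omega>) x')\<^sup>2) \<partial>\<mu>) = S n \<and>
        S n \<le> D n \<and> D n \<le> ln (inverse (w \<mu>)) \<and> ereal (ln (inverse (w \<mu>))) < \<infinity>)
     \<and>
     ((\<forall>h. p h > 0 \<longrightarrow>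
        (\<Sum>x'\<in>UNIV. (predict p h x' - predict \<xi> h x')\<^sup>2) = dist_s p \<xi> h \<and>
        dist_s p \<xi> h \<le> dist_d p \<xi> h) \<and>
      (AE \<omega> in \<mu>. (\<lambda>t. dist_d p \<xi> (stake (t - 1) \<omega>)) \<longlonglongrightarrow> 0))
     \<and>
     (\<forall>x' :: nat \<Rightarrow> 'a stream \<Rightarrow> 'a. (\<forall>t. x' t \<in> measurable \<mu> (count_space UNIV)) \<longrightarrow>
        (AE \<omega> in \<mu>. (\<lambda>t. predict \<xi> (stake (t - 1) \<omega>) (x' t \<omega>)
                        - predict p (stake (t - 1) \<omega>) (x' t \<omega>)) \<longlonglongrightarrow> 0) \<and>
        converges_in_mean_sum \<mu>
          (\<lambda>t \<omega>. predict \<xi> (stake (t - 1) \<omega>) (x' t \<omega>)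
                - predict p (stake (t - 1) \<omega>) (x' t \<omega>)) (\<lambda>\<omega>. 0))
     \<and>
     (\<forall>n\<ge>1.
        (\<Sum>t=1..n. \<integral>\<omega>. (sqrt (predict \<xi> (stake (t - 1) \<omega>) (\<omega> !! (t - 1))
                            / predict p (stake (t - 1) \<omega>) (\<omega> !! (t - 1))) - 1)\<^sup>2 \<partial>\<mu>) \<le> H n \<and>
        H n \<le> D n \<and> D n \<le> ln (inverse (w \<mu>)) \<and> ereal (ln (inverse (w \<mu>))) < \<infinity>)
     \<and>
     (converges_in_mean_sum \<mu>
        (\<lambda>t \<omega>. sqrt (predict \<xi> (stake (t - 1) \<omega>) (\<omega> !! (t - 1))
                    / predict p (stake (t - 1) \<omega>) (\<omega> !! (t - 1)))) (\<lambda>\<omega>. 1) \<and>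
      (AE \<omega> in \<mu>. (\<lambda>t. predict \<xi> (stake (t - 1) \<omega>) (\<omega> !! (t - 1))
                      / predict p (stake (t - 1) \<omega>) (\<omega> !! (t - 1))) \<longlonglongrightarrow> 1))
     \<and>
     ((\<forall>h. p h > 0 \<longrightarrow>
        dist_b p \<xi> h - dist_d p \<xi> h \<le> dist_a p \<xi> h \<and>
        dist_a p \<xi> h \<le> sqrt (2 * dist_d p \<xi> h)) \<and>
      (\<forall>n\<ge>1. B n - D n \<le> A n \<and> A n \<le> sqrt (2 * real n * D n)))"
proof -
  interpret dominating_predictor \<mu> \<xi> "w \<mu>"
    unfolding \<xi>_def by (rule dominating_predictor_mixture) fact+
  note defs = p_def A_def S_def H_def D_def B_def
  have "total_dist \<mu> (dist_s p \<xi>) n \<le> total_dist \<mu> (dist_d p \<xi>) n" for n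
    unfolding p_def by (intro total_dist_mono dist_s_le_dist_d)
  then have i: "(\<Sum>t=1..n. \<integral>\<omega>. (\<Sum>x'\<in>UNIV.
           (predict p (stake (t - 1) \<omega>) x' - predict \<xi> (stake (t - 1) \<omega>) x')\<^sup>2) \<partial>\<mu>) = S n \<and>
        S n \<le> D n \<and> D n \<le> ln (inverse (w \<mu>)) \<and> ereal (ln (inverse (w \<mu>))) < \<infinity>" for n
    using total_d_le[of n] by (simp add: defs total_dist_def dist_s_def)
  have ii: "(AE \<omega> in \<mu>. (\<lambda>t. dist_d p \<xi> (stake (t - 1) \<omega>)) \<longlonglongrightarrow> 0)"
    \<comment> \<open>The sequence starts at \<open>t = 0\<close>, where \<open>t - 1\<close> is
      truncated to 0. Dropping that term turns \<open>t - 1\<close> into the history length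
      \<open>n\<close>.\<close>
    using AE_dist_d_tendsto_0 unfolding p_def by eventually_elim (rule LIMSEQ_imp_Suc, simp)
  have iii: "(AE \<omega> in \<mu>. (\<lambda>t. predict \<xi> (stake (t - 1) \<omega>) (x' t \<omega>)
                        - predict p (stake (t - 1) \<omega>) (x' t \<omega>)) \<longlonglongrightarrow> 0) \<and>
        converges_in_mean_sum \<mu>
          (\<lambda>t \<omega>. predict \<xi> (stake (t - 1) \<omega>) (x' t \<omega>)
                - predict p (stake (t - 1) \<omega>) (x' t \<omega>)) (\<lambda>\<omega>. 0)"
    if "\<forall>t. x' t \<in> measurable \<mu> (count_space UNIV)" for x' :: "nat \<Rightarrow> 'a stream \<Rightarrow> 'a"
  proof
    show "AE \<omega> in \<mu>. (\<lambda>t. predict \<xi> (stake (t - 1) \<omega>) (x' t \<omega>)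
        - predict p (stake (t - 1) \<omega>) (x' t \<omega>)) \<longlonglongrightarrow> 0"
      \<comment> \<open>The symbol \<open>x' t\<close> is predicted from a history of length
        \<open>t - 1\<close>, hence the shift by \<open>Suc\<close>.\<close>
      using AE_predict_diff_tendsto_0[of "\<lambda>n. x' (Suc n)"] unfolding p_def
      by eventually_elim (rule LIMSEQ_imp_Suc, simp)
    have x': "x' (Suc n) \<in> measurable \<mu> (count_space UNIV)" for n
      using that by blast
    have "integrable \<mu> (\<lambda>\<omega>. (predict \<xi> (stake (t - 1) \<omega>) (x' t \<omega>)
        - predict p (stake (t - 1) \<omega>) (x' t \<omega>))\<^sup>2)" if "t \<ge> 1" for t
      using predict_diff_in_mean_sum(1)[of "\<lambda>n. x' (Suc n)" "t - 1", OF x'] that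
      by (simp add: p_def)
    then show "converges_in_mean_sum \<mu> (\<lambda>t \<omega>. predict \<xi> (stake (t - 1) \<omega>) (x' t \<omega>)
        - predict p (stake (t - 1) \<omega>) (x' t \<omega>)) (\<lambda>\<omega>. 0)"
      using predict_diff_in_mean_sum(2)[of "\<lambda>n. x' (Suc n)", OF x']
      by (simp add: converges_in_mean_sum_def p_def)
  qed
  have iv: "(\<Sum>t=1..n. \<integral>\<omega>. (sqrt (predict \<xi> (stake (t - 1) \<omega>) (\<omega> !! (t - 1))
                            / predict p (stake (t - 1) \<omega>) (\<omega> !! (t - 1))) - 1)\<^sup>2 \<partial>\<mu>) \<le> H n \<and>
        H n \<le> D n \<and> D n \<le> ln (inverse (w \<mu>)) \<and> ereal (ln (inverse (w \<mu>))) < \<infinity>" for n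
    using sum_integral_ratio_le[of n] total_h_le_total_d[of n] total_d_le[of n]
    by (simp add: defs sum.atLeast1_atMost_eq)
  have v: "converges_in_mean_sum \<mu>
        (\<lambda>t \<omega>. sqrt (predict \<xi> (stake (t - 1) \<omega>) (\<omega> !! (t - 1))
                    / predict p (stake (t - 1) \<omega>) (\<omega> !! (t - 1)))) (\<lambda>\<omega>. 1)"
    using integrable_ratio summable_integral_ratio
    by (simp add: converges_in_mean_sum_def p_def)
  have v': "AE \<omega> in \<mu>. (\<lambda>t. predict \<xi> (stake (t - 1) \<omega>) (\<omega> !! (t - 1))
                      / predict p (stake (t - 1) \<omega>) (\<omega> !! (t - 1))) \<longlonglongrightarrow> 1"
    using AE_ratio_tendsto_1 unfolding p_def by eventually_elim (rule LIMSEQ_imp_Suc, simp)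
  have vi: "B n - D n \<le> A n \<and> A n \<le> sqrt (2 * real n * D n)" for n
    unfolding defs by (intro conjI total_b_minus_total_d_le total_a_le)
  have h: "dist_s p \<xi> h \<le> dist_d p \<xi> h" "dist_b p \<xi> h - dist_d p \<xi> h \<le> dist_a p \<xi> h"
    "dist_a p \<xi> h \<le> sqrt (2 * dist_d p \<xi> h)" if "p h > 0" for h
    using dist_s_le_dist_d dist_b_minus_dist_d_le dist_a_squared_le[THEN real_le_rsqrt] that
    by (simp_all add: p_def)
  show ?thesis
    using i ii iii iv v v' vi h by (intro conjI allI impI) (simp_all add: dist_s_def)
qed

end
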